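(* Let $(X,\tau)$ be a (real) Hausdorff topological vector space, let $Z$ be a linear subspace of its topological dual $X^*$, and let $C$ be a nonempty bounded convex subset of $X$. Let $\overline{C}$ denote the $\tau$-closure of $C$, and let $f\colon C\to\overline{C}$ be a mapping which is $\tau$-to-$\sigma(X,Z)$ sequentially continuous. Then the following hold: (i) $0\in\overline{\{x-f(x)\colon x\in C\}}^{\sigma(X,Z)}$, i.e. $0$ belongs to the $\sigma(X,Z)$-closure of the set $\{x-f(x)\colon x\in C\}$. (ii) If, moreover, $Z$ is separable in the strong topology (i.e., the topology of uniform convergence on $\tau$-bounded subsets of $X$), then there is a sequence $(z_n)$ in $C$ such that $z_n-f(z_n)$ converges to $0$ in the topology $\sigma(X,Z)$.
   Context: Vector spaces are real. For a topological vector space $(X,\tau)$, a set $A\subset X$ is bounded if for each neighborhood $U$ of zero in $X$ there is a real $r>0$ with $A\subset rU$. $X^*$ is the space of all $\tau$-continuous linear functionals on $X$. For a linear subspace $Z\subset X^*$, $\sigma(X,Z)$ is the weakest topology on $X$ making all elements of $Z$ continuous (it need not be Hausdorff). Sequential continuity of $f$ from $\tau$ to $\sigma(X,Z)$ means: if $x_n\to x$ in $\tau$ with $x_n,x\in C$, then $x^*(f(x_n))\to x^*(f(x))$ for every $x^*\in Z$. *)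

theory Defs
  imports "HOL-Analysis.Analysis"
begin

text \<open>Hausdorffness is not part of the class; it is added as the sort \<open>t2_space\<close>.\<close>

class real_topological_vector = real_vector + topological_ab_group_add +
  assumes tendsto_scaleR_nhds:
    "((\<lambda>p. fst p *\<^sub>R snd p) \<longlongrightarrow> a *\<^sub>R x) (nhds a \<times>\<^sub>F nhds x)"

instance real_normed_vector \<subseteq> real_topological_vector
proof
  fix a :: real and x :: 'a
  have "((\<lambda>p. fst p *\<^sub>R snd p) \<longlongrightarrow> fst (a, x) *\<^sub>R snd (a, x)) (nhds (a, x))"
    by (intro tendsto_intros filterlim_ident)
  then show "((\<lambda>p. fst p *\<^sub>R snd p) \<longlongrightarrow> a *\<^sub>R x) (nhds a \<times>\<^sub>F nhds x)"
    by (simp add: nhds_prod)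
qed

text \<open>Boundedness in the sense of topological vector spaces; the library's \<open>bounded\<close> is metric.
  The premise \<open>0 \<in> interior U\<close> says that \<open>U\<close> is a (not necessarily open) neighbourhood of zero.\<close>

definition tvs_bounded :: "'a::real_topological_vector set \<Rightarrow> bool" where
  "tvs_bounded A \<longleftrightarrow> (\<forall>U. 0 \<in> interior U \<longrightarrow> (\<exists>r>0. A \<subseteq> (\<lambda>x. r *\<^sub>R x) ` U))"

definition topological_dual :: "('a::real_topological_vector \<Rightarrow> real) set" where
  "topological_dual = {\<phi>. linear \<phi> \<and> continuous_on UNIV \<phi>}"

text \<open>The library has no \<open>real_vector\<close> structure on function types, so linear subspaces of the
  dual are described by their pointwise closure properties.\<close>

definition dual_subspace :: "('a::real_topological_vector \<Rightarrow> real) set \<Rightarrow> bool" where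
  "dual_subspace Z \<longleftrightarrow>
     Z \<subseteq> topological_dual \<and>
     (\<lambda>x. 0) \<in> Z \<and>
     (\<forall>\<phi>\<in>Z. \<forall>\<psi>\<in>Z. (\<lambda>x. \<phi> x + \<psi> x) \<in> Z) \<and>
     (\<forall>c. \<forall>\<phi>\<in>Z. (\<lambda>x. c * \<phi> x) \<in> Z)"

text \<open>The topology \<open>\<sigma>(X,Z)\<close>. Adding \<open>UNIV\<close> to the subbase only matters for empty \<open>Z\<close>.\<close>

definition weak_topology :: "('a \<Rightarrow> real) set \<Rightarrow> 'a topology" where
  "weak_topology Z = topology_generated_by (insert UNIV {\<phi> -` U |\<phi> U. \<phi> \<in> Z \<and> open U})"

lemma topspace_weak_topology [simp]: "topspace (weak_topology Z) = UNIV"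
  by (auto simp: weak_topology_def topology_generated_by_topspace)

lemma continuous_map_weak_topology:
  assumes "\<phi> \<in> Z"
  shows "continuous_map (weak_topology Z) euclidean \<phi>"
  using assms unfolding continuous_map_def
  by (auto simp: weak_topology_def vimage_def intro!: topology_generated_by_Basis)

lemma weak_topology_weakest:
  assumes "topspace T = UNIV" "\<And>\<phi>. \<phi> \<in> Z \<Longrightarrow> continuous_map T euclidean \<phi>"
    and "openin (weak_topology Z) W"
  shows "openin T W"
proof -
  have "generate_topology_on (insert UNIV {\<phi> -` U |\<phi> U. \<phi> \<in> Z \<and> open U}) W"
    using assms(3) by (simp add: weak_topology_def openin_topology_generated_by_iff)
  then show ?thesis
  proof (induction rule: generate_topology_on.induct)
    case (Basis s)
    then consider "s = UNIV" | \<phi> U where "s = \<phi> -` U" "\<phi> \<in> Z" "open U" by blast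
    then show ?case
    proof cases
      case 1
      then show ?thesis using assms(1) openin_topspace by metis
    next
      case 2
      then show ?thesis
        using assms(1) assms(2)[of \<phi>] unfolding continuous_map_def by (simp add: vimage_def)
    qed
  qed auto
qed

definition seq_continuous_weak ::
  "('a::real_topological_vector \<Rightarrow> real) set \<Rightarrow> 'a set \<Rightarrow> ('a \<Rightarrow> 'a) \<Rightarrow> bool" where
  "seq_continuous_weak Z C f \<longleftrightarrow>
     (\<forall>u x. (\<forall>n. u n \<in> C) \<longrightarrow> x \<in> C \<longrightarrow> u \<longlonglongrightarrow> x \<longrightarrow>
        (\<forall>\<phi>\<in>Z. (\<lambda>n. \<phi> (f (u n))) \<longlonglongrightarrow> \<phi> (f x)))"

text \<open>The topology of uniform convergence on bounded sets is generated by the balls of the seminorms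
  \<open>\<phi> \<mapsto> (SUP x\<in>B. \<bar>\<phi> x\<bar>)\<close> with \<open>B\<close> bounded. The suprema are finite because continuous functionals
  are bounded on bounded sets; \<open>B\<close> is taken nonempty because \<open>Sup {}\<close> is unspecified on the reals.\<close>

definition strong_dual_topology :: "('a::real_topological_vector \<Rightarrow> real) topology" where
  "strong_dual_topology = topology_generated_by
     {{\<psi> \<in> topological_dual. (SUP x\<in>B. \<bar>\<psi> x - \<phi> x\<bar>) < e} |\<phi> B e.
        \<phi> \<in> topological_dual \<and> tvs_bounded B \<and> B \<noteq> {} \<and> 0 < e}"

end

theory Submission
  imports Defs
begin

text \<open>
  For finitely many functionals \<open>\<Phi> \<subseteq> Z\<close> and \<open>e > 0\<close>, the bounded set \<open>C\<close> has a finite subset that is an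
  \<open>e\<close>-net of \<open>closure C\<close> with respect to \<open>\<Phi>\<close>. Composing \<open>f\<close>, restricted to the convex hull of the net,
  with the Schauder projection back onto that hull gives a self-map of a finite-dimensional simplex
  in barycentric coordinates. Sequential continuity of \<open>f\<close> is enough to make it continuous, and a
  Brouwer fixed point \<open>x\<close> satisfies \<open>\<bar>\<phi> (x - f x)\<bar> \<le> e\<close> for all \<open>\<phi> \<in> \<Phi>\<close>, which is (i). For (ii), apply this
  to the first \<open>n\<close> members of a strongly dense sequence of \<open>Z\<close> with \<open>e = 1 / n\<close>: uniform approximation
  on \<open>C\<close> extends to \<open>closure C\<close>, so convergence along the sequence passes to all of \<open>Z\<close>.

  Brouwer's theorem is derived from Kuhn's lemma for maps of real sequences, because the size of
  the net is not bounded in advance and the library version has the dimension in the type.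
\<close>

section \<open>Brouwer's theorem on the cube, in coordinates\<close>

text \<open>Kuhn's lemma on the grid of mesh \<open>1 / p\<close>: labelling grid points by the
  direction in which \<open>F\<close> moves coordinate \<open>i\<close> yields a cell that carries
  both labels for every \<open>i\<close>. Its lowest corner gives \<open>q\<close>; \<open>a\<close>
  and \<open>b\<close> are corners of that cell and may change with \<open>i\<close>.\<close>

lemma cube_approximate_fixed_point:
  fixes F :: "(nat \<Rightarrow> real) \<Rightarrow> nat \<Rightarrow> real" and n p :: nat
  assumes p: "0 < p"
    and range: "\<And>s i. \<forall>j<n. s j \<in> {0..1} \<Longrightarrow> i < n \<Longrightarrow> F s i \<in> {0..1}"
  shows "\<exists>q. (\<forall>j<n. q j \<in> {0..1}) \<and>
    (\<forall>i<n. \<exists>a b. (\<forall>j<n. a j \<in> {0..1} \<and> b j \<in> {0..1} \<and> \<bar>a j - q j\<bar> \<le> 1 / p \<and> \<bar>b j - q j\<bar> \<le> 1 / p) \<and>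
      a i \<le> F a i \<and> F b i \<le> b i)"
proof -
  define g where "g x = (\<lambda>j. real (x j) / real p)" for x :: "nat \<Rightarrow> nat"
  \<comment> \<open>Kuhn's lemma demands label 1 on the face \<open>x i = p\<close>. It still means
    \<open>F (g x) i \<le> g x i\<close> there, because \<open>F\<close> is at most 1; on the face
    \<open>x i = 0\<close> the label is 0 because \<open>F\<close> is nonnegative.\<close>
  define label where
    "label x i = (if x i < p \<and> g x i \<le> F (g x) i then 0 else 1::nat)" for x i
  have g01: "g x j \<in> {0..1}" if "x j \<le> p" for x j
    using p that by (simp add: g_def)
  have Fg: "F (g x) i \<in> {0..1}" if "\<forall>j<n. x j \<le> p" "i < n" for x i
    using that g01 by (intro range) blast+
  obtain q where q: "\<forall>i<n. q i < p"
    and rs: "\<forall>i<n. \<exists>r s. (\<forall>j<n. q j \<le> r j \<and> r j \<le> q j + 1) \<and>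
      (\<forall>j<n. q j \<le> s j \<and> s j \<le> q j + 1) \<and> label r i \<noteq> label s i"
  proof (rule kuhn_lemma[OF p, of n label])
    show "\<forall>x. (\<forall>i<n. x i \<le> p) \<longrightarrow> (\<forall>i<n. x i = 0 \<longrightarrow> label x i = 0)"
      using p Fg by (auto simp: label_def g_def)
  qed (auto simp: label_def)
  have near: "\<bar>g r j - g q j\<bar> \<le> 1 / p" if "q j \<le> r j" "r j \<le> q j + 1" for r j
  proof -
    have "\<bar>g r j - g q j\<bar> = \<bar>real (r j) - real (q j)\<bar> / p"
      by (simp add: g_def flip: diff_divide_distrib)
    also have "\<dots> \<le> 1 / p"
      using that by (intro divide_right_mono) auto
    finally show ?thesis .
  qed
  have low: "g r i \<le> F (g r) i" if "label r i = 0" for r i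
    using that by (auto simp: label_def split: if_splits)
  have high: "F (g r) i \<le> g r i" if "label r i \<noteq> 0" "\<forall>j<n. r j \<le> p" "i < n" for r i
  proof (cases "r i < p")
    case True
    then show ?thesis using that by (auto simp: label_def split: if_splits)
  next
    case False
    then have "g r i = 1" using that p by (force simp: g_def)
    then show ?thesis using Fg[of r i] that by auto
  qed
  have "\<exists>a b. (\<forall>j<n. a j \<in> {0..1} \<and> b j \<in> {0..1} \<and> \<bar>a j - g q j\<bar> \<le> 1 / p \<and> \<bar>b j - g q j\<bar> \<le> 1 / p) \<and>
      a i \<le> F a i \<and> F b i \<le> b i" if i: "i < n" for i
  proof -
    obtain r s where r: "\<forall>j<n. q j \<le> r j \<and> r j \<le> q j + 1"
      and s: "\<forall>j<n. q j \<le> s j \<and> s j \<le> q j + 1" and "label r i \<noteq> label s i"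
      using rs i by blast
    then consider "label r i = 0" "label s i \<noteq> 0" | "label s i = 0" "label r i \<noteq> 0"
      by (auto simp: label_def split: if_splits)
    moreover have le: "\<forall>j<n. r j \<le> p" "\<forall>j<n. s j \<le> p"
      using r s q by fastforce+
    moreover have box: "\<forall>j<n. g r j \<in> {0..1} \<and> \<bar>g r j - g q j\<bar> \<le> 1 / p"
      "\<forall>j<n. g s j \<in> {0..1} \<and> \<bar>g s j - g q j\<bar> \<le> 1 / p"
      using r s le near g01 by simp_all
    ultimately show ?thesis
    proof cases
      case 1
      with box low[of r i] high[of s i] le i show ?thesis
        by (intro exI[of _ "g r"] exI[of _ "g s"]) simp
    next
      case 2
      with box low[of s i] high[of r i] le i show ?thesis
        by (intro exI[of _ "g s"] exI[of _ "g r"]) simp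
    qed
  qed
  moreover have "\<forall>j<n. g q j \<in> {0..1}"
    using q g01 by (simp add: less_imp_le)
  ultimately show ?thesis by blast
qed

text \<open>With mesh \<open>1 / Suc k\<close>, the corners \<open>q k\<close> have a convergent
  subsequence. The points witnessing the two opposite inequalities tend to the same limit
  \<open>l\<close>, where continuity turns the inequalities into an equality.\<close>

lemma brouwer_cube_coordinates:
  fixes F :: "(nat \<Rightarrow> real) \<Rightarrow> nat \<Rightarrow> real" and n :: nat
  assumes range: "\<And>s i. \<forall>j<n. s j \<in> {0..1} \<Longrightarrow> i < n \<Longrightarrow> F s i \<in> {0..1}"
    and cont: "\<And>u s i. \<forall>k. \<forall>j<n. u k j \<in> {0..1} \<Longrightarrow> \<forall>j<n. s j \<in> {0..1} \<Longrightarrow>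
      \<forall>j<n. (\<lambda>k. u k j) \<longlonglongrightarrow> s j \<Longrightarrow> i < n \<Longrightarrow> (\<lambda>k. F (u k) i) \<longlonglongrightarrow> F s i"
  obtains s where "\<forall>j<n. s j \<in> {0..1}" "\<forall>i<n. F s i = s i"
proof -
  define P where "P k q i a b \<longleftrightarrow> (\<forall>j<n. a j \<in> {0..1} \<and> b j \<in> {0..1} \<and>
      \<bar>a j - q j\<bar> \<le> 1 / Suc k \<and> \<bar>b j - q j\<bar> \<le> 1 / Suc k) \<and> a i \<le> F a i \<and> F b i \<le> b i"
    for k q i a b
  have "\<exists>q. (\<forall>j<n. q j \<in> {0..1}) \<and> (\<forall>i<n. \<exists>a b. P k q i a b)" for k
    unfolding P_def by (rule cube_approximate_fixed_point) (use range in auto)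
  then obtain q where q: "\<And>k j. j < n \<Longrightarrow> q k j \<in> {0..1}"
    and ab: "\<And>k i. i < n \<Longrightarrow> \<exists>a b. P k (q k) i a b"
    by metis
  \<comment> \<open>Bolzano-Weierstrass for the finitely many coordinates below \<open>n\<close>,
    with one common subsequence.\<close>
  have "\<forall>d\<subseteq>{..<n}. \<exists>l::nat \<Rightarrow> real. \<exists>r. strict_mono r \<and>
      (\<forall>e>0. eventually (\<lambda>k. \<forall>i\<in>d. dist (q (r k) i) (l i) < e) sequentially)"
  proof (rule compact_lemma_general[where unproj = "\<lambda>x. x"])
    show "bounded ((\<lambda>x. x j) ` range q)" if "j \<in> {..<n}" for j
      using q that by (intro bounded_subset[OF bounded_closed_interval[of 0 1]]) auto
  qed auto
  then obtain l r where r: "strict_mono r"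
    and "\<forall>e>0. eventually (\<lambda>k. \<forall>i\<in>{..<n}. dist (q (r k) i) (l i) < e) sequentially"
    by blast
  then have lim: "(\<lambda>k. q (r k) j) \<longlonglongrightarrow> l j" if "j < n" for j
    using that by (auto simp: tendsto_iff elim!: eventually_mono)
  have l01: "\<forall>j<n. l j \<in> {0..1}"
  proof (intro allI impI)
    fix j assume "j < n"
    then show "l j \<in> {0..1}"
      using closed_sequentially[OF closed_atLeastAtMost, of "\<lambda>k. q (r k) j" 0 1 "l j"] q lim by simp
  qed
  have near: "(\<lambda>k. c k j) \<longlonglongrightarrow> l j"
    if "j < n" "\<And>k. \<bar>c k j - q (r k) j\<bar> \<le> 1 / Suc (r k)" for c :: "nat \<Rightarrow> nat \<Rightarrow> real" and j
  proof -
    have "(\<lambda>k. 1 / real (Suc (r k))) \<longlonglongrightarrow> 0"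
      using LIMSEQ_subseq_LIMSEQ[OF LIMSEQ_Suc[OF lim_1_over_n] r] by (simp add: o_def)
    then have "(\<lambda>k. c k j - q (r k) j) \<longlonglongrightarrow> 0"
      by (rule Lim_null_comparison[rotated])
        (intro always_eventually allI, unfold real_norm_def, rule that(2))
    from tendsto_add[OF this lim[OF that(1)]] show ?thesis by simp
  qed
  have "F l i = l i" if i: "i < n" for i
  proof -
    from ab[OF i] obtain a b where ab: "\<And>k. P k (q k) i (a k) (b k)"
      by metis
    then have ab: "\<And>k j. j < n \<Longrightarrow> a k j \<in> {0..1} \<and> b k j \<in> {0..1} \<and>
        \<bar>a k j - q k j\<bar> \<le> 1 / Suc k \<and> \<bar>b k j - q k j\<bar> \<le> 1 / Suc k"
      and F: "\<And>k. a k i \<le> F (a k) i" "\<And>k. F (b k) i \<le> b k i"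
      unfolding P_def by blast+
    have a: "(\<lambda>k. a (r k) j) \<longlonglongrightarrow> l j" and b: "(\<lambda>k. b (r k) j) \<longlonglongrightarrow> l j" if "j < n" for j
      using near[of j "\<lambda>k. a (r k)"] near[of j "\<lambda>k. b (r k)"] ab that by simp_all
    have Fa: "(\<lambda>k. F (a (r k)) i) \<longlonglongrightarrow> F l i"
      by (rule cont) (use a ab l01 i in auto)
    have Fb: "(\<lambda>k. F (b (r k)) i) \<longlonglongrightarrow> F l i"
      by (rule cont) (use b ab l01 i in auto)
    have "l i \<le> F l i" "F l i \<le> l i"
      using LIMSEQ_le[OF a[OF i] Fa] LIMSEQ_le[OF Fb b[OF i]] F by auto
    then show ?thesis by simp
  qed
  then show ?thesis by (intro that[OF l01]) blast
qed

section \<open>Continuous functionals and weak neighbourhoods\<close>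

lemma tendsto_scaleR_tvs:
  fixes g :: "'b \<Rightarrow> 'a::real_topological_vector"
  assumes "(c \<longlongrightarrow> a) F" "(g \<longlongrightarrow> x) F"
  shows "((\<lambda>k. c k *\<^sub>R g k) \<longlongrightarrow> a *\<^sub>R x) F"
proof -
  have "filterlim (\<lambda>k. (c k, g k)) (nhds a \<times>\<^sub>F nhds x) F"
    using assms by (rule filterlim_Pair)
  from filterlim_compose[OF tendsto_scaleR_nhds this] show ?thesis by simp
qed

text \<open>The preimage of the interval from -1 to 1 is a neighbourhood of zero, so some multiple
  \<open>r\<close> of it absorbs \<open>C\<close>, and \<open>r\<close> is then a bound.\<close>

lemma topological_dual_bounded:
  assumes "\<phi> \<in> topological_dual" "tvs_bounded C"
  shows "bdd_above ((\<lambda>x. \<bar>\<phi> x\<bar>) ` C)"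
proof -
  interpret linear \<phi> using assms(1) by (simp add: topological_dual_def)
  let ?U = "\<phi> -` {-1<..<1}"
  have "open ?U"
    using assms(1) by (intro open_vimage) (auto simp: topological_dual_def)
  then have "0 \<in> interior ?U"
    by (simp add: interior_open zero)
  then obtain r where "r > 0" "C \<subseteq> (*\<^sub>R) r ` ?U"
    using assms(2) unfolding tvs_bounded_def by blast
  moreover have "\<bar>r * t\<bar> \<le> r" if "-1 < t" "t < 1" for t :: real
    using \<open>r > 0\<close> that by (simp add: abs_mult mult_left_le)
  ultimately have "\<bar>\<phi> x\<bar> \<le> r" if "x \<in> C" for x
    using that by (fastforce simp: scaleR)
  then show ?thesis by (rule bdd_aboveI2)
qed

text \<open>Induction over the generation of \<open>W\<close>: an intersection unites the two finite
  families and takes the smaller radius, a union uses the member containing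
  \<open>a\<close>.\<close>

lemma weak_topology_neighbourhood:
  assumes "openin (weak_topology Z) W" "a \<in> W"
  obtains \<Phi> e where "finite \<Phi>" "\<Phi> \<subseteq> Z" "e > 0" "{x. \<forall>\<phi>\<in>\<Phi>. \<bar>\<phi> x - \<phi> a\<bar> < e} \<subseteq> W"
proof -
  have "generate_topology_on (insert UNIV {\<phi> -` U |\<phi> U. \<phi> \<in> Z \<and> open U}) W"
    using assms(1) by (simp add: weak_topology_def openin_topology_generated_by_iff)
  then have "\<exists>\<Phi> e. finite \<Phi> \<and> \<Phi> \<subseteq> Z \<and> e > 0 \<and> {x. \<forall>\<phi>\<in>\<Phi>. \<bar>\<phi> x - \<phi> a\<bar> < e} \<subseteq> W"
    using assms(2)
  proof (induction rule: generate_topology_on.induct)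
    case (Int V W)
    from Int.IH(1) Int.prems obtain \<Phi> d where
      "finite \<Phi>" "\<Phi> \<subseteq> Z" "d > 0" "{x. \<forall>\<phi>\<in>\<Phi>. \<bar>\<phi> x - \<phi> a\<bar> < d} \<subseteq> V"
      by blast
    moreover from Int.IH(2) Int.prems obtain \<Psi> e where
      "finite \<Psi>" "\<Psi> \<subseteq> Z" "e > 0" "{x. \<forall>\<phi>\<in>\<Psi>. \<bar>\<phi> x - \<phi> a\<bar> < e} \<subseteq> W"
      by blast
    ultimately show ?case
      by (intro exI[of _ "\<Phi> \<union> \<Psi>"] exI[of _ "min d e"]) auto
  next
    case (UN K)
    then obtain W where "W \<in> K" "a \<in> W" by blast
    with UN.IH[OF this] show ?case by (meson Union_upper subset_trans)
  next
    case (Basis s)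
    then consider "s = UNIV" | \<phi> U where "s = \<phi> -` U" "\<phi> \<in> Z" "open U" by blast
    then show ?case
    proof cases
      case 1
      then show ?thesis by (intro exI[of _ "{}"] exI[of _ 1]) auto
    next
      case 2
      then obtain e where "e > 0" "\<And>y. dist y (\<phi> a) < e \<Longrightarrow> y \<in> U"
        using Basis.prems by (auto simp: open_dist)
      then show ?thesis
        using 2 by (intro exI[of _ "{\<phi>}"] exI[of _ e]) (auto simp: dist_real_def)
    qed
  qed auto
  with that show ?thesis by blast
qed

section \<open>Finite nets and approximate fixed points\<close>

text \<open>The values of the functionals in \<Phi> on \<open>C\<close> lie in a bounded box, which
  finitely many grid cells of side \<open>e / 2\<close> cover. The net takes one point of
  \<open>C\<close> from each occupied cell. A point of the closure is within \<open>e / 2\<close> of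
  some \<open>c\<close> in \<open>C\<close>, and \<open>c\<close> is within \<open>e / 2\<close> of
  its representative.\<close>

lemma finite_net:
  fixes C :: "'a::real_topological_vector set"
  assumes "finite \<Phi>" "\<Phi> \<subseteq> topological_dual" "tvs_bounded C" "e > 0"
  obtains S where "finite S" "S \<subseteq> C"
    "\<And>y. y \<in> closure C \<Longrightarrow> \<exists>c\<in>S. \<forall>\<phi>\<in>\<Phi>. \<bar>\<phi> y - \<phi> c\<bar> < e"
proof -
  \<comment> \<open>The index of the grid cell of \<open>c\<close>, made extensional so that its
    values lie in a finite \<open>PiE\<close> set.\<close>
  define h where "h c = (\<lambda>\<phi>\<in>\<Phi>. \<lfloor>2 * \<phi> c / e\<rfloor>)" for c :: 'a
  have "\<exists>r. \<forall>x\<in>C. \<bar>\<phi> x\<bar> \<le> r" if "\<phi> \<in> \<Phi>" for \<phi>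
    using topological_dual_bounded[of \<phi> C] assms(2,3) that by (auto simp: bdd_above_def)
  then obtain r where r: "\<And>\<phi> x. \<phi> \<in> \<Phi> \<Longrightarrow> x \<in> C \<Longrightarrow> \<bar>\<phi> x\<bar> \<le> r \<phi>"
    by metis
  have "h ` C \<subseteq> (\<Pi>\<^sub>E \<phi>\<in>\<Phi>. {\<lfloor>2 * - r \<phi> / e\<rfloor>..\<lfloor>2 * r \<phi> / e\<rfloor>})"
  proof (intro image_subsetI PiE_I)
    fix c \<phi> assume "c \<in> C" "\<phi> \<in> \<Phi>"
    then have "- r \<phi> \<le> \<phi> c" "\<phi> c \<le> r \<phi>" using r[of \<phi> c] by auto
    then have "2 * - r \<phi> / e \<le> 2 * \<phi> c / e" "2 * \<phi> c / e \<le> 2 * r \<phi> / e"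
      using \<open>e > 0\<close> by (simp_all only: divide_le_cancel mult_le_cancel_left_pos zero_less_numeral) simp_all
    then show "h c \<phi> \<in> {\<lfloor>2 * - r \<phi> / e\<rfloor>..\<lfloor>2 * r \<phi> / e\<rfloor>}"
      using \<open>\<phi> \<in> \<Phi>\<close> by (simp only: h_def restrict_apply' atLeastAtMost_iff floor_mono simp_thms)
  qed (simp add: h_def)
  then have fin: "finite (h ` C)"
    using finite_subset finite_PiE[OF assms(1)] by (metis (no_types, lifting) finite_atLeastAtMost_int)
  show ?thesis
  proof
    show "finite (inv_into C h ` h ` C)" using fin by simp
    show "inv_into C h ` h ` C \<subseteq> C" by (auto intro: inv_into_into)
    fix y assume y: "y \<in> closure C"
    let ?U = "\<Inter>\<phi>\<in>\<Phi>. \<phi> -` {\<phi> y - e / 2<..<\<phi> y + e / 2}"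
    have "open ?U"
      using assms by (intro open_INT open_vimage ballI) (auto simp: topological_dual_def)
    moreover have "y \<in> ?U" using \<open>e > 0\<close> by auto
    ultimately obtain c where c: "c \<in> C" "c \<in> ?U"
      using y open_Int_closure_eq_empty[of ?U C] by blast
    let ?d = "inv_into C h (h c)"
    have "\<bar>\<phi> y - \<phi> ?d\<bar> < e" if \<phi>: "\<phi> \<in> \<Phi>" for \<phi>
    proof -
      have "h ?d \<phi> = h c \<phi>" using c by (simp add: f_inv_into_f)
      then have "\<lfloor>2 * \<phi> ?d / e\<rfloor> = \<lfloor>2 * \<phi> c / e\<rfloor>" using \<phi> by (simp add: h_def)
      then have "\<bar>2 * \<phi> ?d / e - 2 * \<phi> c / e\<bar> < 1" by linarith
      then have "\<bar>\<phi> ?d - \<phi> c\<bar> < e / 2"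
        using \<open>e > 0\<close> by (simp add: abs_if field_simps split: if_splits)
      moreover have "\<bar>\<phi> y - \<phi> c\<bar> < e / 2" using c \<phi> by (auto simp: abs_if)
      ultimately show ?thesis by linarith
    qed
    then show "\<exists>d\<in>inv_into C h ` h ` C. \<forall>\<phi>\<in>\<Phi>. \<bar>\<phi> y - \<phi> d\<bar> < e"
      using c by blast
  qed
qed

text \<open>The projection gives positive weight only to net points within \<open>e\<close> of
  \<open>f x\<close>. At a fixed point, \<open>x\<close> is therefore a convex combination of points
  that every functional in \<Phi> sees within \<open>e\<close> of \<open>f x\<close>.\<close>

lemma approximate_fixed_point:
  fixes C :: "'a::real_topological_vector set"
  assumes Z: "dual_subspace Z" and C: "C \<noteq> {}" "tvs_bounded C" "convex C"
    and fC: "f ` C \<subseteq> closure C" and f: "seq_continuous_weak Z C f"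
    and \<Phi>: "finite \<Phi>" "\<Phi> \<subseteq> Z" and e: "e > 0"
  obtains x where "x \<in> C" "\<forall>\<phi>\<in>\<Phi>. \<bar>\<phi> (x - f x)\<bar> \<le> e"
proof -
  have dual: "\<Phi> \<subseteq> topological_dual"
    using Z \<Phi> by (auto simp: dual_subspace_def)
  obtain S where S: "finite S" "S \<subseteq> C"
    and net: "\<And>y. y \<in> closure C \<Longrightarrow> \<exists>c\<in>S. \<forall>\<phi>\<in>\<Phi>. \<bar>\<phi> y - \<phi> c\<bar> < e"
    using finite_net[OF \<Phi>(1) dual C(2) e] by blast
  obtain p where "bij_betw p {0..<card S} S"
    using ex_bij_betw_nat_finite[OF S(1)] by blast
  moreover define m where "m = card S"
  ultimately have p: "p ` {..<m} = S"
    by (simp add: bij_betw_def atLeast0LessThan)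
  have "S \<noteq> {}" using net C(1) closure_subset by fast
  then have m: "m > 0" using S by (simp add: m_def card_gt_0_iff)

  \<comment> \<open>Unnormalised weights of a Schauder projection onto the convex hull of \<open>S\<close>: \<open>lam i y > 0\<close> only if
    \<open>y\<close> is within \<open>e\<close> of \<open>p i\<close> for every functional in \<open>\<Phi>\<close>.\<close>
  define lam where "lam i y = (\<Prod>\<phi>\<in>\<Phi>. max 0 (e - \<bar>\<phi> y - \<phi> (p i)\<bar>))" for i y
  have lam_nonneg: "lam i y \<ge> 0" for i y
    by (simp add: lam_def prod_nonneg)
  have lam_pos: "(\<Sum>j<m. lam j y) > 0" if y: "y \<in> closure C" for y
  proof -
    obtain i where i: "i < m" "\<forall>\<phi>\<in>\<Phi>. \<bar>\<phi> y - \<phi> (p i)\<bar> < e"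
      using net[OF y] p by auto
    then have "lam i y > 0" by (auto simp: lam_def intro!: prod_pos)
    with i show ?thesis using lam_nonneg by (intro sum_pos2[of _ i]) auto
  qed
  have lam_near: "\<bar>\<phi> y - \<phi> (p i)\<bar> \<le> e" if "lam i y \<noteq> 0" "\<phi> \<in> \<Phi>" for i y \<phi>
    using that \<Phi>(1) by (auto simp: lam_def max_def split: if_splits)

  \<comment> \<open>A retraction of the cube onto the standard simplex; the simplex itself is not needed, since
    every fixed point of \<open>F\<close> lies in it.\<close>
  define w where
    "w s i = (s i + max 0 (1 - (\<Sum>j<m. s j)) / m) / max 1 (\<Sum>j<m. s j)" for s :: "nat \<Rightarrow> real" and i
  \<comment> \<open>\<open>X\<close> turns weights into a point of the hull of \<open>S\<close>;
    \<open>F\<close> returns the barycentric coordinates of the projected image under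
    \<open>f\<close>.\<close>
  define X where "X s = (\<Sum>i<m. w s i *\<^sub>R p i)" for s
  define F where "F s i = lam i (f (X s)) / (\<Sum>j<m. lam j (f (X s)))" for s i
  have w_nonneg: "w s i \<ge> 0" if "\<forall>j<m. s j \<in> {0..1}" "i < m" for s i
    using that by (auto simp: w_def intro!: divide_nonneg_pos)
  \<comment> \<open>A total below 1 has its deficit spread evenly over the \<open>m\<close>
    coordinates; a total above 1 is scaled down.\<close>
  have w_sum: "(\<Sum>i<m. w s i) = 1" for s
    using m by (simp add: w_def sum.distrib flip: sum_divide_distrib) (simp add: max_def)
  have X: "X s \<in> C" if "\<forall>j<m. s j \<in> {0..1}" for s
    unfolding X_def using w_sum w_nonneg[OF that] p S C(3) by (intro convex_sum) auto
  have fX: "f (X s) \<in> closure C" if "\<forall>j<m. s j \<in> {0..1}" for s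
    using X[OF that] fC by blast

  have F_sum: "(\<Sum>i<m. F s i) = 1" if "\<forall>j<m. s j \<in> {0..1}" for s
    using lam_pos[OF fX[OF that]] by (simp add: F_def flip: sum_divide_distrib)
  have F_nonneg: "F s i \<ge> 0" for s i
    using lam_nonneg by (simp add: F_def sum_nonneg)
  have F_range: "F s i \<in> {0..1}" if "\<forall>j<m. s j \<in> {0..1}" "i < m" for s i
    using member_le_sum[of i "{..<m}" "F s"] F_sum[OF that(1)] that(2) F_nonneg by simp
  have F_cont: "(\<lambda>k. F (u k) i) \<longlonglongrightarrow> F s i"
    if u: "\<forall>k. \<forall>j<m. u k j \<in> {0..1}" and s: "\<forall>j<m. s j \<in> {0..1}"
      and us: "\<forall>j<m. (\<lambda>k. u k j) \<longlonglongrightarrow> s j" and "i < m" for u s i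
  proof -
    have "(\<lambda>k. w (u k) j) \<longlonglongrightarrow> w s j" if "j < m" for j
      unfolding w_def using us that m by (intro tendsto_intros) auto
    then have "(\<lambda>k. X (u k)) \<longlonglongrightarrow> X s"
      unfolding X_def by (intro tendsto_sum tendsto_scaleR_tvs tendsto_const) auto
    moreover have "\<forall>k. X (u k) \<in> C" "X s \<in> C"
      using X u s by simp_all
    \<comment> \<open>The weights \<open>lam\<close> see \<open>f\<close> only through functionals
      in \<Phi>, so weak sequential continuity of \<open>f\<close> along a convergent sequence in
      \<open>C\<close> suffices.\<close>
    ultimately have "\<forall>\<phi>\<in>Z. (\<lambda>k. \<phi> (f (X (u k)))) \<longlonglongrightarrow> \<phi> (f (X s))"
      using f[unfolded seq_continuous_weak_def, rule_format, of "\<lambda>k. X (u k)" "X s"] by simp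
    then have "(\<lambda>k. \<phi> (f (X (u k)))) \<longlonglongrightarrow> \<phi> (f (X s))" if "\<phi> \<in> \<Phi>" for \<phi>
      using that \<Phi>(2) by blast
    then have "(\<lambda>k. lam j (f (X (u k)))) \<longlonglongrightarrow> lam j (f (X s))" for j
      unfolding lam_def by (intro tendsto_intros) auto
    then show ?thesis
      unfolding F_def using lam_pos[OF fX[OF s]] by (intro tendsto_intros) auto
  qed

  obtain s where s: "\<forall>j<m. s j \<in> {0..1}" and Fs: "\<forall>i<m. F s i = s i"
    using brouwer_cube_coordinates[of m F, OF F_range F_cont] by blast
  have s_sum: "(\<Sum>i<m. s i) = 1"
    using F_sum[OF s] Fs by simp
  then have w: "w s i = s i" for i
    by (simp add: w_def)
  let ?x = "X s"
  have "\<bar>\<phi> (?x - f ?x)\<bar> \<le> e" if \<phi>: "\<phi> \<in> \<Phi>" for \<phi>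
  proof -
    interpret linear \<phi> using \<phi> dual by (auto simp: topological_dual_def)
    \<comment> \<open>The factor \<open>(\<Sum>i<m. s i)\<close>, equal to 1, turns the difference
      into a weighted average of differences.\<close>
    have "\<phi> (?x - f ?x) = (\<Sum>i<m. s i * \<phi> (p i)) - (\<Sum>i<m. s i) * \<phi> (f ?x)"
      by (simp add: diff X_def sum scaleR w s_sum)
    also have "\<dots> = (\<Sum>i<m. s i * (\<phi> (p i) - \<phi> (f ?x)))"
      by (simp add: sum_distrib_right right_diff_distrib sum_subtractf)
    also have "\<bar>\<dots>\<bar> \<le> (\<Sum>i<m. s i * e)"
    proof (rule order_trans[OF sum_abs sum_mono])
      fix i assume "i \<in> {..<m}"
      then have i: "s i \<ge> 0" "F s i = s i" using s Fs by auto
      show "\<bar>s i * (\<phi> (p i) - \<phi> (f ?x))\<bar> \<le> s i * e"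
      proof (cases "s i = 0")
        case False
        then have "lam i (f ?x) \<noteq> 0" using i by (auto simp: F_def)
        from lam_near[OF this \<phi>] i(1) show ?thesis
          by (simp add: abs_mult abs_minus_commute mult_left_mono)
      qed simp
    qed
    also have "\<dots> = e" by (simp add: s_sum flip: sum_distrib_right)
    finally show ?thesis .
  qed
  with X[OF s] show ?thesis by (intro that ballI)
qed

section \<open>Density in the strong dual topology\<close>

lemma strong_dual_neighbourhood:
  assumes "\<phi> \<in> topological_dual" "tvs_bounded B" "B \<noteq> {}" "e > 0"
  shows "openin strong_dual_topology {\<psi> \<in> topological_dual. (SUP x\<in>B. \<bar>\<psi> x - \<phi> x\<bar>) < e}"
  unfolding strong_dual_topology_def
  by (rule topology_generated_by_Basis) (use assms in blast)

lemma topological_dual_diff: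
  assumes "\<phi> \<in> topological_dual" "\<psi> \<in> topological_dual"
  shows "(\<lambda>x. \<psi> x - \<phi> x) \<in> topological_dual"
  using assms by (auto simp: topological_dual_def intro!: linear_compose_sub continuous_intros)

text \<open>\<open>C\<close> is itself bounded, so strong density approximates each functional
  uniformly on \<open>C\<close>. The non-strict bound describes a closed set and hence extends to
  \<open>closure C\<close>.\<close>

lemma strongly_dense_sequence:
  assumes Z: "dual_subspace Z" and "separable_space (subtopology strong_dual_topology Z)"
    and C: "tvs_bounded C" "C \<noteq> {}"
  obtains \<phi> :: "nat \<Rightarrow> 'a::real_topological_vector \<Rightarrow> real"
  where "range \<phi> \<subseteq> Z"
    "\<forall>\<psi>\<in>Z. \<forall>e>0. \<exists>n. \<forall>x\<in>closure C. \<bar>\<phi> n x - \<psi> x\<bar> \<le> e"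
proof -
  let ?T = "subtopology strong_dual_topology Z"
  have Zdual: "Z \<subseteq> topological_dual" "Z \<noteq> {}"
    using Z by (auto simp: dual_subspace_def)
  let ?N = "\<lambda>\<psi> e. {\<eta> \<in> topological_dual. (SUP x\<in>C. \<bar>\<eta> x - \<psi> x\<bar>) < e}"
  have N: "openin strong_dual_topology (?N \<psi> e)" "\<psi> \<in> ?N \<psi> e" if "\<psi> \<in> Z" "e > 0" for \<psi> e
    using that Zdual C strong_dual_neighbourhood[of \<psi> C e] by auto
  \<comment> \<open>The topspace of the strong topology is the union of its generators; it contains
    \<open>Z\<close> because each functional lies in its own ball of radius 1.\<close>
  then have top: "topspace ?T = Z"
    using N(1)[THEN openin_subset] N(2) by (force intro: zero_less_one)
  obtain D where D: "countable D" "D \<subseteq> Z" "?T closure_of D = Z"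
    using assms(2) top by (auto simp: separable_space_def)
  with Zdual have "D \<noteq> {}" by auto
  show ?thesis
  proof (rule that; (intro ballI allI impI)?)
    show "range (from_nat_into D) \<subseteq> Z"
      using range_from_nat_into_subset[OF \<open>D \<noteq> {}\<close>] D(2) by blast
    fix \<psi> :: "'a \<Rightarrow> real" and e :: real assume \<psi>: "\<psi> \<in> Z" and "e > 0"
    then have "openin ?T (Z \<inter> ?N \<psi> e)" "\<psi> \<in> Z \<inter> ?N \<psi> e"
      using N(1) N(2) by (blast intro: openin_subtopology_Int2)+
    moreover have "\<psi> \<in> ?T closure_of D" using D(3) \<psi> by simp
    ultimately have "\<exists>\<eta>\<in>D. \<eta> \<in> Z \<inter> ?N \<psi> e"
      using in_closure_of[THEN iffD1, THEN conjunct2, rule_format, of \<psi> ?T D "Z \<inter> ?N \<psi> e"]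
      by (simp add: Bex_def)
    then obtain \<eta> where \<eta>: "\<eta> \<in> D" "\<eta> \<in> ?N \<psi> e" by blast
    let ?\<delta> = "\<lambda>x. \<eta> x - \<psi> x"
    have \<delta>: "?\<delta> \<in> topological_dual"
      using \<eta> \<psi> Zdual by (intro topological_dual_diff) auto
    have "\<bar>?\<delta> x\<bar> \<le> e" if "x \<in> C" for x
      using cSUP_upper[OF that topological_dual_bounded[OF \<delta> C(1)]] \<eta>(2) by simp
    moreover have "closed {x. \<bar>?\<delta> x\<bar> \<le> e}"
      using \<eta>(2) \<psi> Zdual(1)
      by (intro closed_Collect_le continuous_intros) (auto simp: topological_dual_def)
    ultimately have "closure C \<subseteq> {x. \<bar>?\<delta> x\<bar> \<le> e}"
      by (intro closure_minimal) auto
    moreover obtain n where "\<eta> = from_nat_into D n"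
      using from_nat_into_surj[OF D(1) \<eta>(1)] by metis
    ultimately show "\<exists>n. \<forall>x\<in>closure C. \<bar>from_nat_into D n x - \<psi> x\<bar> \<le> e" by blast
  qed
qed

section \<open>Weak closure and the approximating sequence\<close>

theorem theorem2p1:
  fixes Z :: "('a::{real_topological_vector, t2_space} \<Rightarrow> real) set"
    and C :: "'a set"
    and f :: "'a \<Rightarrow> 'a"
  assumes "dual_subspace Z"
    and "C \<noteq> {}" and "tvs_bounded C" and "convex C"
    and "f ` C \<subseteq> closure C"
    and "seq_continuous_weak Z C f"
  shows "0 \<in> weak_topology Z closure_of {x - f x |x. x \<in> C} \<and>
    (separable_space (subtopology strong_dual_topology Z) \<longrightarrow>
      (\<exists>z. (\<forall>n. z n \<in> C) \<and> limitin (weak_topology Z) (\<lambda>n. z n - f (z n)) 0 sequentially))"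
proof (intro conjI impI)
  have lin: "linear \<phi>" if "\<phi> \<in> Z" for \<phi>
    using that assms(1) by (auto simp: dual_subspace_def topological_dual_def)
  show "0 \<in> weak_topology Z closure_of {x - f x |x. x \<in> C}"
    unfolding in_closure_of
  proof (intro conjI allI impI; (elim conjE)?)
    fix W assume "0 \<in> W" "openin (weak_topology Z) W"
    then obtain \<Phi> e where \<Phi>: "finite \<Phi>" "\<Phi> \<subseteq> Z" and "e > 0"
      and W: "{x. \<forall>\<phi>\<in>\<Phi>. \<bar>\<phi> x - \<phi> 0\<bar> < e} \<subseteq> W"
      by (elim weak_topology_neighbourhood[rotated])
    have zero: "\<phi> 0 = 0" if "\<phi> \<in> \<Phi>" for \<phi>
      using lin \<Phi>(2) that linear_0 by blast
    \<comment> \<open>Halving \<open>e\<close> turns the non-strict bound into the strict one that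
      defines the neighbourhood.\<close>
    obtain x where x: "x \<in> C" "\<forall>\<phi>\<in>\<Phi>. \<bar>\<phi> (x - f x)\<bar> \<le> e / 2"
      using approximate_fixed_point[OF assms \<Phi>, of "e / 2"] \<open>e > 0\<close> by auto
    have "\<bar>\<phi> (x - f x) - \<phi> 0\<bar> < e" if "\<phi> \<in> \<Phi>" for \<phi>
      using bspec[OF x(2) that] zero[OF that] \<open>e > 0\<close> by simp
    then have "x - f x \<in> W"
      using W by blast
    with x(1) show "\<exists>y. y \<in> {x - f x |x. x \<in> C} \<and> y \<in> W" by blast
  qed simp
  assume "separable_space (subtopology strong_dual_topology Z)"
  then obtain \<phi> :: "nat \<Rightarrow> 'a \<Rightarrow> real" where \<phi>: "range \<phi> \<subseteq> Z"
    and dense: "\<forall>\<psi>\<in>Z. \<forall>e>0. \<exists>n. \<forall>x\<in>closure C. \<bar>\<phi> n x - \<psi> x\<bar> \<le> e"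
    by (rule strongly_dense_sequence[OF assms(1) _ assms(3,2)])
  have "\<exists>x\<in>C. \<forall>i\<le>n. \<bar>\<phi> i (x - f x)\<bar> \<le> 1 / Suc n" for n
  proof -
    have "finite (\<phi> ` {..n})" "\<phi> ` {..n} \<subseteq> Z" "0 < 1 / real (Suc n)"
      using \<phi> by auto
    then obtain x where "x \<in> C" "\<forall>\<psi>\<in>\<phi> ` {..n}. \<bar>\<psi> (x - f x)\<bar> \<le> 1 / real (Suc n)"
      by (rule approximate_fixed_point[OF assms])
    then show ?thesis by blast
  qed
  then obtain z where z: "\<And>n. z n \<in> C"
    and small: "\<And>n i. i \<le> n \<Longrightarrow> \<bar>\<phi> i (z n - f (z n))\<bar> \<le> 1 / Suc n"
    by metis
  have lim: "(\<lambda>n. \<psi> (z n - f (z n))) \<longlonglongrightarrow> 0" if \<psi>: "\<psi> \<in> Z" for \<psi>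
  proof (rule tendstoI)
    fix e :: real assume "e > 0"
    \<comment> \<open>Replacing \<psi> by \<open>\<phi> i\<close> costs \<open>e / 4\<close> at
      \<open>z n\<close> and \<open>e / 4\<close> at \<open>f (z n)\<close>, which leaves
      \<open>e / 2\<close> for \<open>\<phi> i\<close> itself. The point \<open>f (z n)\<close> is
      only known to lie in \<open>closure C\<close>, hence the uniform bound there.\<close>
    then obtain i where i: "\<forall>x\<in>closure C. \<bar>\<phi> i x - \<psi> x\<bar> \<le> e / 4"
      using dense \<psi> by (metis divide_pos_pos zero_less_numeral)
    have "(\<lambda>n. 1 / real (Suc n)) \<longlonglongrightarrow> 0"
      using LIMSEQ_Suc[OF lim_1_over_n] by simp
    then have "\<forall>\<^sub>F n in sequentially. 1 / real (Suc n) < e / 2"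
      using \<open>e > 0\<close> by (intro order_tendstoD) auto
    with eventually_ge_at_top[of i]
    show "\<forall>\<^sub>F n in sequentially. dist (\<psi> (z n - f (z n))) 0 < e"
    proof eventually_elim
      case (elim n)
      have "z n \<in> closure C" "f (z n) \<in> closure C"
        using z assms(5) closure_subset by blast+
      with i have "\<bar>\<phi> i (z n) - \<psi> (z n)\<bar> \<le> e / 4" "\<bar>\<phi> i (f (z n)) - \<psi> (f (z n))\<bar> \<le> e / 4"
        by blast+
      moreover have "\<bar>\<phi> i (z n - f (z n))\<bar> < e / 2"
        using small[OF elim(1)] elim(2) by linarith
      moreover have "linear \<psi>" "linear (\<phi> i)"
        using lin \<psi> \<phi> by auto
      ultimately show ?case
        by (simp only: linear_diff dist_real_def diff_0_right abs_less_iff abs_le_iff) linarith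
    qed
  qed
  have "limitin (weak_topology Z) (\<lambda>n. z n - f (z n)) 0 sequentially"
    unfolding limitin_def
  proof (intro conjI allI impI; (elim conjE)?)
    fix W assume "openin (weak_topology Z) W" "0 \<in> W"
    then obtain \<Phi> e where \<Phi>: "finite \<Phi>" "\<Phi> \<subseteq> Z" and "e > 0"
      and W: "{x. \<forall>\<phi>\<in>\<Phi>. \<bar>\<phi> x - \<phi> 0\<bar> < e} \<subseteq> W"
      by (rule weak_topology_neighbourhood)
    have "\<forall>\<^sub>F n in sequentially. \<forall>\<psi>\<in>\<Phi>. \<bar>\<psi> (z n - f (z n)) - \<psi> 0\<bar> < e"
    proof (intro eventually_ball_finite ballI \<Phi>(1))
      fix \<psi> assume "\<psi> \<in> \<Phi>"
      then have "\<psi> \<in> Z" using \<Phi>(2) by blast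
      then show "\<forall>\<^sub>F n in sequentially. \<bar>\<psi> (z n - f (z n)) - \<psi> 0\<bar> < e"
        using tendstoD[OF lim \<open>e > 0\<close>, of \<psi>] linear_0[OF lin, of \<psi>] by (simp add: dist_real_def)
    qed
    then show "\<forall>\<^sub>F n in sequentially. z n - f (z n) \<in> W"
      by (rule eventually_mono) (use W in blast)
  qed simp
  with z show "\<exists>z. (\<forall>n. z n \<in> C) \<and> limitin (weak_topology Z) (\<lambda>n. z n - f (z n)) 0 sequentially"
    by blast
qed

end
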